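(* Let $\lambda=\frac12+\frac{\sqrt{2}}{8}$. Then for all $r\in(0,1)$, $$\frac{\pi}{(1+r')^3}\left\{\left[\lambda+(1-\lambda)r'\right]^2+\left[(1-\lambda)+\lambda r'\right]^2\right\}^{2}>\frac{\pi}{2}\left(\frac{1+{r'}^{3/2}}{2}\right)^{2/3}.$$
   Context: For $r\in(0,1)$, $r'=\sqrt{1-r^2}$. *)

theory Defs
  imports Complex_Main
begin

end

(* Put t = sqrt r'.  After cubing and clearing denominators, the claim says that a polynomial in t
   is positive on (0,1).  This polynomial is divisible by (1 - t)^4, and in the cofactor every
   negative coefficient is dominated by the coefficient of the next lower power. *)
theory Submission
  imports Defs
begin

text \<open>Each negative term of the cofactor is bracketed with its predecessor, so that every
  summand is visibly positive for \<open>0 < t < 1\<close>.\<close>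

lemma key_polynomial_factorization:
  fixes t :: real
  shows "4 * (9 * t^4 + 14 * t^2 + 9)^6 - 2^21 * (1 + t^2)^9 * (1 + t^3)^2
    = (1 - t)^4 *
      (28612 + 114448 * t + 1252216 * t^2 + 242320 * t^3
       + t^4 * (8299636 - 1109696 * t) + t^6 * (26454944 - 5560768 * t)
       + t^8 * (50390984 - 10463520 * t) + t^10 * (62028240 - 10463520 * t)
       + t^12 * (50390984 - 5560768 * t) + t^14 * (26454944 - 1109696 * t)
       + 8299636 * t^16 + 242320 * t^17 + 1252216 * t^18 + 114448 * t^19 + 28612 * t^20)"
  by algebra

lemma key_polynomial_less:
  fixes t :: real
  assumes "0 < t" "t < 1"
  shows "2^21 * (1 + t^2)^9 * (1 + t^3)^2 < 4 * (9 * t^4 + 14 * t^2 + 9)^6"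
proof -
  have "0 < 4 * (9 * t^4 + 14 * t^2 + 9)^6 - 2^21 * (1 + t^2)^9 * (1 + t^3)^2"
    unfolding key_polynomial_factorization using assms
    by (intro mult_pos_pos add_pos_pos zero_less_power) simp_all
  then show ?thesis by simp
qed

text \<open>Cubing is strictly increasing on nonnegative reals and trades the fractional exponent
  for integer powers.\<close>

lemma powr_two_thirds_less:
  fixes a b :: real
  assumes "0 < a" "0 < b" "a^2 < b^3"
  shows "a powr (2/3) < b"
proof -
  have "(a powr (2/3))^3 = a^2"
    using assms by (simp add: powr_power)
  then show ?thesis
    using assms power_less_imp_less_base[of "a powr (2/3)" 3 b] by simp
qed

theorem mainTheorem3:
  fixes lam r r' :: real
  assumes l_def: "lam = 1/2 + sqrt 2 / 8"
    and r: "r \<in> {0<..<1}"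
    and r': "r' = sqrt (1 - r\<^sup>2)"
  shows "pi / (1 + r') ^ 3 * ((lam + (1 - lam) * r')\<^sup>2 + ((1 - lam) + lam * r')\<^sup>2)\<^sup>2
       > pi / 2 * ((1 + r' powr (3/2)) / 2) powr (2/3)"
proof -
  define t where "t = sqrt r'"
  have "0 < r\<^sup>2" "r\<^sup>2 < 1"
    using r by (auto simp: power_less_one_iff)
  then have r'_bounds: "0 < r'" "r' < 1"
    using r' by auto
  then have t: "0 < t" "t < 1" and r't: "r' = t^2"
    by (auto simp: t_def)
  have powr_t: "r' powr (3/2) = t^3"
    using r'_bounds by (simp add: t_def powr_half_sqrt[symmetric] powr_power)
  \<comment> \<open>This is 8 (1 + t^2)^2 + (1 - t^2)^2, which is 16 times the sum of squares in the
    claim.\<close>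
  define D where "D = 9 * t^4 + 14 * t^2 + 9"
  have D_pos: "0 < D"
    unfolding D_def using t by (intro add_pos_pos) simp_all
  have sum_squares: "(lam + (1 - lam) * r')\<^sup>2 + ((1 - lam) + lam * r')\<^sup>2 = D / 16"
  proof -
    \<comment> \<open>With \<open>lam\<close> = 1/2 + \<open>s\<close>, the two squared terms are (1
      + r')/2 plus and minus \<open>s\<close> (1 - r'). The cross terms cancel, so only
      \<open>s^2\<close> survives and the square root disappears.\<close>
    define s where "s = sqrt 2 / 8"
    have "s^2 = 1 / 32"
      by (simp add: s_def power_divide)
    have "(lam + (1 - lam) * r')\<^sup>2 + ((1 - lam) + lam * r')\<^sup>2
        = (1 + t^2)^2 / 2 + 2 * s^2 * (1 - t^2)^2"
      unfolding l_def r't s_def[symmetric] by (simp add: field_simps) algebra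
    also have "\<dots> = D / 16"
      unfolding \<open>s^2 = 1 / 32\<close> D_def by (simp add: field_simps) algebra
    finally show ?thesis .
  qed
  \<comment> \<open>The larger side of the claim, divided by pi / 2.\<close>
  define W where "W = D^2 / (128 * (1 + t^2)^3)"
  have den_pos: "0 < 1 + t^2"
    using t by (simp add: add_pos_pos)
  have W_pos: "0 < W"
    unfolding W_def using D_pos den_pos by simp
  have "((1 + t^3) / 2)^2 < W^3"
  proof -
    have W3: "W^3 = D^6 / (2^21 * (1 + t^2)^9)"
      by (simp add: W_def power_divide power_mult_distrib flip: power_mult)
    \<comment> \<open>Here 2^21 = 128^3 comes from the denominator of \<open>W^3\<close>, and 4 from
      squaring the 1/2 in \<open>(1 + t^3) / 2\<close>.\<close>
    have "2^21 * (1 + t^2)^9 * (1 + t^3)^2 < 4 * D^6"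
      unfolding D_def using t by (rule key_polynomial_less)
    then show ?thesis
      unfolding W3 using den_pos by (simp add: power_divide pos_less_divide_eq mult_ac)
  qed
  then have "((1 + t^3) / 2) powr (2/3) < W"
    using t W_pos by (intro powr_two_thirds_less) (simp_all add: add_pos_pos)
  then have "pi / 2 * ((1 + t^3) / 2) powr (2/3) < pi / 2 * W"
    by simp
  also have "pi / 2 * W = pi / (1 + t^2)^3 * (D / 16)^2"
    by (simp add: W_def power_divide)
  finally show ?thesis
    unfolding sum_squares powr_t unfolding r't .
qed

end
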